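(* Let $\varepsilon>0$ and let $F\colon \mathbb{R}^2 \to \mathbb{R}^2$ be a $C^1$ map such that, for all $p\in\mathbb{R}^2$, the derivative $DF_p$ is neither a homothety nor has simple real eigenvalues. Suppose that either (a) $\operatorname{Spec}(F)\cap\left(\{x\in\mathbb{R} : |x|\ge 1\}\cup\{0\}\right)=\emptyset$, or (b) $\operatorname{Spec}(F)\cap\{x\in\mathbb{R} : |x|\le 1+\varepsilon\}=\emptyset$. Then $\#\operatorname{Fix}(F^2)\le 1$.
   Context: For a differentiable map $F\colon\mathbb{R}^2\to\mathbb{R}^2$, $\operatorname{Spec}(F)$ denotes the set of all complex eigenvalues of the derivatives $DF_p$ as $p$ ranges over $\mathbb{R}^2$. $F^2=F\circ F$ is the second iterate, and $\operatorname{Fix}(H)$ denotes the set of fixed points of a map $H$. A homothety is a linear map of the form $\lambda\,\mathrm{Id}$ with $\lambda\in\mathbb{R}$. A simple real eigenvalue is a real eigenvalue of algebraic multiplicity one; thus the hypothesis on $DF_p$ says that $DF_p$ either has no real eigenvalue or has a double real eigenvalue without being a multiple of the identity. *)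

theory Defs
  imports "HOL-Analysis.Analysis" "HOL-Computational_Algebra.Polynomial"
begin

definition C1_map :: "('a::real_normed_vector \<Rightarrow> 'b::real_normed_vector) \<Rightarrow> bool" where
  "C1_map F \<longleftrightarrow>
     (\<exists>F' :: 'a \<Rightarrow> 'a \<Rightarrow>\<^sub>L 'b.
        (\<forall>p. (F has_derivative blinfun_apply (F' p)) (at p)) \<and> continuous_on UNIV F')"

abbreviation deriv_at :: "('a::real_normed_vector \<Rightarrow> 'b::real_normed_vector) \<Rightarrow> 'a \<Rightarrow> 'a \<Rightarrow> 'b" where
  "deriv_at F p \<equiv> frechet_derivative F (at p)"

definition homothety :: "('a::real_vector \<Rightarrow> 'a) \<Rightarrow> bool" where
  "homothety L \<longleftrightarrow> (\<exists>c::real. L = (\<lambda>v. c *\<^sub>R v))"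

definition eigenvalue :: "'a::field ^ 'n ^ 'n \<Rightarrow> 'a \<Rightarrow> bool" where
  "eigenvalue A x \<longleftrightarrow> (\<exists>v. v \<noteq> 0 \<and> A *v v = x *s v)"

definition charpoly :: "'a::comm_ring_1 ^ 'n ^ 'n \<Rightarrow> 'a poly" where
  "charpoly A = det (mat [:0, 1:] - map_matrix (\<lambda>a. [:a:]) A)"

definition simple_eigenvalue :: "'a::field ^ 'n ^ 'n \<Rightarrow> 'a \<Rightarrow> bool" where
  "simple_eigenvalue A x \<longleftrightarrow> eigenvalue A x \<and> order x (charpoly A) = 1"

text \<open>The matrix is complexified, so that \<open>Spec F\<close> also contains the non-real eigenvalues
  of the derivatives.\<close>

definition Spec :: "(real ^ 'n \<Rightarrow> real ^ 'n) \<Rightarrow> complex set" where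
  "Spec F = {z. \<exists>p. eigenvalue (map_matrix complex_of_real (matrix (deriv_at F p))) z}"

definition Fix :: "('a \<Rightarrow> 'a) \<Rightarrow> 'a set" where
  "Fix H = {x. H x = x}"

end

theory Submission
  imports Defs
begin

text \<open>For a planar linear map \<open>A\<close> that is not a homothety and has no simple real eigenvalue, the
  quadratic form \<open>v \<mapsto> v \<and> A v\<close> is semidefinite and nonzero, and the sign of \<open>A\<^sub>2\<^sub>1 - A\<^sub>1\<^sub>2 \<noteq> 0\<close>
  decides which sign it takes. By connectedness of the plane this sign does not depend on the
  point, so \<open>(q - p) \<and> (F q - F p)\<close> has a weak sign that is the same for all \<open>p, q\<close>. If \<open>p \<noteq> q\<close>
  are fixed by \<open>F \<circ> F\<close>, put \<open>w = q - p\<close> and \<open>w' = F q - F p\<close>: both \<open>w \<and> w'\<close> and \<open>w' \<and> w\<close> have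
  that sign, so they vanish. Then the form vanishes at \<open>w\<close> along the whole segment from \<open>p\<close> to
  \<open>q\<close>, and the mean value theorem makes the factor \<open>\<lambda>\<close> in \<open>w' = \<lambda> w\<close> an eigenvalue of some
  derivative. The same holds for the factor \<open>\<mu>\<close> in \<open>w = \<mu> w'\<close>, and \<open>\<lambda> \<mu> = 1\<close> contradicts either
  spectral assumption.\<close>

section \<open>Wedge product in the plane\<close>

definition wedge :: "real ^ 2 \<Rightarrow> real ^ 2 \<Rightarrow> real" where
  "wedge v w = v $ 1 * w $ 2 - v $ 2 * w $ 1"

lemma wedge_swap: "wedge w v = - wedge v w"
  by (simp add: wedge_def)

lemma bounded_linear_wedge: "bounded_linear (wedge v)"
  unfolding wedge_def by (intro bounded_linear_intros bounded_linear_vec_nth)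

text \<open>Up to scaling, the two scalars are the coordinates of \<open>x\<close> in the orthogonal
  frame made of \<open>w\<close> and its quarter turn.\<close>

lemma inner_wedge_eq_0_imp_eq_0:
  assumes "wedge w x = 0" "w \<bullet> x = 0" "w \<noteq> 0"
  shows "x = 0"
proof -
  have n: "(w $ 1)\<^sup>2 + (w $ 2)\<^sup>2 \<noteq> 0"
    using assms(3) by (auto simp: vec_eq_iff forall_2 sum_power2_eq_zero_iff)
  have e: "w $ 1 * x $ 2 - w $ 2 * x $ 1 = 0" "w $ 1 * x $ 1 + w $ 2 * x $ 2 = 0"
    using assms(1,2) by (auto simp: wedge_def inner_vec_def sum_2)
  have "((w $ 1)\<^sup>2 + (w $ 2)\<^sup>2) * x $ 1 = 0" "((w $ 1)\<^sup>2 + (w $ 2)\<^sup>2) * x $ 2 = 0"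
    using e by algebra+
  then show ?thesis
    using n by (auto simp: vec_eq_iff forall_2)
qed

lemma wedge_eq_0_imp_parallel:
  assumes "wedge w x = 0" "w \<noteq> 0"
  obtains c where "x = c *\<^sub>R w"
proof
  let ?c = "(w \<bullet> x) / (w \<bullet> w)"
  have "wedge w (x - ?c *\<^sub>R w) = 0"
    using assms(1) by (simp add: wedge_def algebra_simps)
  moreover have "w \<bullet> (x - ?c *\<^sub>R w) = 0"
    using assms(2) by (simp add: inner_diff_right)
  ultimately show "x = ?c *\<^sub>R w"
    using inner_wedge_eq_0_imp_eq_0 assms(2) by force
qed

section \<open>Real 2x2 matrices without simple eigenvalues\<close>

lemma charpoly_2:
  fixes A :: "real ^ 2 ^ 2"
  shows "charpoly A = [:A $ 1 $ 1 * A $ 2 $ 2 - A $ 1 $ 2 * A $ 2 $ 1, - A $ 1 $ 1 - A $ 2 $ 2, 1:]"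
  by (simp add: charpoly_def det_2 mat_def map_matrix_def)

text \<open>A positive discriminant would give the characteristic polynomial two distinct real
  roots, hence simple ones.\<close>

lemma disc_nonpos_if_no_simple_eigenvalue:
  fixes A :: "real ^ 2 ^ 2"
  assumes "\<not> (\<exists>x. simple_eigenvalue A x)"
  shows "(A $ 1 $ 1 - A $ 2 $ 2)\<^sup>2 + 4 * A $ 1 $ 2 * A $ 2 $ 1 \<le> 0"
proof (rule ccontr)
  define a b c d where "a = A $ 1 $ 1" "b = A $ 1 $ 2" "c = A $ 2 $ 1" "d = A $ 2 $ 2"
  note defs = this
  define s where "s = sqrt ((a - d)\<^sup>2 + 4 * b * c)"
  assume "\<not> ?thesis"
  then have s: "s > 0" "s\<^sup>2 = (a - d)\<^sup>2 + 4 * b * c"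
    by (auto simp: s_def defs)
  define r r' where "r = (a + d + s) / 2" and "r' = (a + d - s) / 2"
  have sum: "r + r' = a + d" and ne: "r \<noteq> r'"
    using s(1) by (auto simp: r_def r'_def field_simps)
  have prod: "r * r' = a * d - b * c"
    using s(2) by (simp add: r_def r'_def power2_eq_square field_simps)
  have cp: "charpoly A = [:- r, 1:] * [:- r', 1:]"
    using sum prod by (simp add: charpoly_2 defs algebra_simps)
  have "order r (charpoly A) = order r [:- r, 1:] + order r [:- r', 1:]"
    unfolding cp by (rule order_mult) simp
  also have "order r [:- r', 1:] = 0"
    using ne by (intro order_0I) simp
  also have "order r [:- r, 1:] = 1"
    using order_power_n_n[of r 1] by simp
  finally have ord: "order r (charpoly A) = 1" by simp
  have rr: "(r - a) * (r - d) = b * c"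
    using sum prod by algebra
  have eig: "eigenvalue A r" if "x \<noteq> 0 \<or> y \<noteq> 0" "a * x + b * y = r * x" "c * x + d * y = r * y" for x y
  proof -
    have "(vector [x, y] :: real ^ 2) \<noteq> 0" "A *v vector [x, y] = r *s vector [x, y]"
      using that by (auto simp: vec_eq_iff forall_2 matrix_vector_mult_def sum_2 vector_2 defs)
    then show ?thesis unfolding eigenvalue_def by blast
  qed
  \<comment> \<open>The vector (b, r - a) is killed by the first row of A - r, and by the second
    because \<open>rr\<close> says that this matrix is singular. If it is zero, (r - d, c) does the
    same with the rows exchanged; both being zero would give r = a = d and so r' = r.\<close>
  have "eigenvalue A r"
  proof (cases "b = 0 \<and> r = a")
    case False
    then show ?thesis
      using rr by (intro eig[of b "r - a"]) (auto simp: algebra_simps)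
  next
    case True
    have "r - d \<noteq> 0 \<or> c \<noteq> 0"
      using True s ne sum by auto
    then show ?thesis
      using rr by (intro eig[of "r - d" c]) (auto simp: algebra_simps)
  qed
  with ord assms show False
    by (auto simp: simple_eigenvalue_def)
qed

lemma homothety_if_scalar:
  fixes L :: "real ^ 2 \<Rightarrow> real ^ 2"
  assumes "linear L" "matrix L $ 1 $ 2 = 0" "matrix L $ 2 $ 1 = 0" "matrix L $ 1 $ 1 = matrix L $ 2 $ 2"
  shows "homothety L"
  unfolding homothety_def
proof (intro exI ext)
  fix v
  have "L v = matrix L *v v"
    using assms(1) by simp
  also have "\<dots> = matrix L $ 1 $ 1 *\<^sub>R v"
    using assms(2-4) by (simp add: vec_eq_iff forall_2 matrix_vector_mult_def sum_2)
  finally show "L v = matrix L $ 1 $ 1 *\<^sub>R v" .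
qed

text \<open>For a symmetric matrix the discriminant is a sum of two squares, which vanishes only for
  scalar matrices.\<close>

lemma offdiag_neq_if_disc_nonpos:
  fixes L :: "real ^ 2 \<Rightarrow> real ^ 2"
  assumes "linear L" "\<not> homothety L"
    and disc: "(matrix L $ 1 $ 1 - matrix L $ 2 $ 2)\<^sup>2 + 4 * matrix L $ 1 $ 2 * matrix L $ 2 $ 1 \<le> 0"
  shows "matrix L $ 2 $ 1 - matrix L $ 1 $ 2 \<noteq> 0"
proof
  assume "matrix L $ 2 $ 1 - matrix L $ 1 $ 2 = 0"
  then have eq: "matrix L $ 2 $ 1 = matrix L $ 1 $ 2" by simp
  have "(matrix L $ 1 $ 1 - matrix L $ 2 $ 2)\<^sup>2 + (2 * matrix L $ 1 $ 2)\<^sup>2 \<le> 0"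
    using disc by (simp add: eq power2_eq_square)
  then have "matrix L $ 1 $ 1 - matrix L $ 2 $ 2 = 0 \<and> 2 * matrix L $ 1 $ 2 = 0"
    by (simp only: sum_power2_le_zero_iff)
  then show False
    using homothety_if_scalar[OF assms(1)] assms(2) eq by auto
qed

text \<open>As a binary quadratic form, \<open>wedge v (L v)\<close> has the same discriminant as
  the characteristic polynomial, and the trace of its Gram matrix is the off-diagonal difference,
  which therefore carries its sign.\<close>

lemma wedge_semidefinite_if_disc_nonpos:
  fixes L :: "real ^ 2 \<Rightarrow> real ^ 2"
  assumes "linear L"
    and disc: "(matrix L $ 1 $ 1 - matrix L $ 2 $ 2)\<^sup>2 + 4 * matrix L $ 1 $ 2 * matrix L $ 2 $ 1 \<le> 0"
  shows "0 \<le> (matrix L $ 2 $ 1 - matrix L $ 1 $ 2) * wedge v (L v)"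
proof -
  define a b c d where "a = matrix L $ 1 $ 1" "b = matrix L $ 1 $ 2" "c = matrix L $ 2 $ 1" "d = matrix L $ 2 $ 2"
  note defs = this
  define x y where "x = v $ 1" and "y = v $ 2"
  have "L v = matrix L *v v"
    using assms(1) by simp
  then have w: "wedge v (L v) = c * x\<^sup>2 + (d - a) * x * y - b * y\<^sup>2"
    by (simp add: wedge_def matrix_vector_mult_def sum_2 defs x_def y_def algebra_simps power2_eq_square)
  \<comment> \<open>complete the square in \<open>x\<close> for the factor \<open>c\<close>, in \<open>y\<close> for the factor \<open>- b\<close>\<close>
  have "4 * ((c - b) * wedge v (L v)) =
      (2 * c * x + (d - a) * y)\<^sup>2 + (2 * b * y - (d - a) * x)\<^sup>2 - ((a - d)\<^sup>2 + 4 * b * c) * (x\<^sup>2 + y\<^sup>2)"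
    unfolding w by algebra
  moreover have "((a - d)\<^sup>2 + 4 * b * c) * (x\<^sup>2 + y\<^sup>2) \<le> 0"
    using disc by (intro mult_nonpos_nonneg) (auto simp: defs)
  moreover have "0 \<le> (2 * c * x + (d - a) * y)\<^sup>2 + (2 * b * y - (d - a) * x)\<^sup>2"
    by simp
  ultimately have "0 \<le> (c - b) * wedge v (L v)" by linarith
  then show ?thesis by (simp add: defs)
qed

section \<open>Real spectrum, continuity of the derivative, calculus along segments\<close>

lemma of_real_in_Spec:
  fixes F :: "real ^ 'n \<Rightarrow> real ^ 'n"
  assumes "F differentiable at z" "deriv_at F z w = c *\<^sub>R w" "w \<noteq> 0"
  shows "complex_of_real c \<in> Spec F"
proof -
  let ?A = "matrix (deriv_at F z)" and ?w = "(\<chi> i. complex_of_real (w $ i)) :: complex ^ 'n"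
  have "linear (deriv_at F z)"
    using assms(1) by (rule linear_frechet_derivative)
  then have Aw: "?A *v w = c *\<^sub>R w"
    using assms(2) by simp
  have "(\<Sum>j\<in>UNIV. complex_of_real (?A $ i $ j) * complex_of_real (w $ j)) = complex_of_real ((?A *v w) $ i)" for i
    by (simp add: matrix_vector_mult_def)
  then have "map_matrix complex_of_real ?A *v ?w = complex_of_real c *s ?w"
    unfolding Aw by (simp add: vec_eq_iff matrix_vector_mult_def map_matrix_def)
  moreover have "?w \<noteq> 0"
    using assms(3) by (auto simp: vec_eq_iff)
  ultimately show ?thesis
    unfolding Spec_def eigenvalue_def by blast
qed

lemma constant_sign_on_connected:
  fixes f :: "'a::topological_space \<Rightarrow> real"
  assumes "connected S" "continuous_on S f" "\<And>x. x \<in> S \<Longrightarrow> f x \<noteq> 0" "x \<in> S" "y \<in> S"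
  shows "0 < f x * f y"
proof (rule ccontr)
  have "connected (f ` S)"
    using assms(1,2) by (rule connected_continuous_image[rotated])
  then have *: "0 \<in> f ` S" if "a \<in> S" "b \<in> S" "f a \<le> 0" "0 \<le> f b" for a b
    using that unfolding connected_iff_interval by blast
  assume "\<not> ?thesis"
  then have "f x \<le> 0 \<and> 0 \<le> f y \<or> f y \<le> 0 \<and> 0 \<le> f x"
    by (auto simp: not_less mult_le_0_iff)
  then have "0 \<in> f ` S"
    using * assms(4,5) by blast
  then show False
    using assms(3) by auto
qed

lemma continuous_on_matrix_deriv_at:
  fixes F :: "real ^ 'n \<Rightarrow> real ^ 'm"
  assumes "C1_map F"
  shows "continuous_on UNIV (\<lambda>p. matrix (deriv_at F p) $ i $ j)"
proof -
  obtain F' where F': "\<And>p. (F has_derivative blinfun_apply (F' p)) (at p)" "continuous_on UNIV F'"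
    using assms by (auto simp: C1_map_def)
  have "matrix (deriv_at F p) $ i $ j = F' p (axis j 1) $ i" for p
    using frechet_derivative_at[OF F'(1)[of p]] by (simp add: matrix_def)
  then show ?thesis
    by (simp add: F'(2) continuous_intros)
qed

text \<open>The functional \<open>l\<close> is left general to serve both the component along
  \<open>w\<close> (inner product) and the one across it (wedge).\<close>

lemma has_real_derivative_along_segment:
  fixes F :: "'a::real_normed_vector \<Rightarrow> 'b::real_normed_vector"
  assumes "F differentiable at (p + t *\<^sub>R w)" "bounded_linear l"
  shows "((\<lambda>t. l (F (p + t *\<^sub>R w))) has_real_derivative l (deriv_at F (p + t *\<^sub>R w) w)) (at t)"
proof -
  let ?D = "deriv_at F (p + t *\<^sub>R w)"
  have FD: "(F has_derivative ?D) (at (p + t *\<^sub>R w))"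
    using assms(1) frechet_derivative_works by blast
  have "((\<lambda>t. p + t *\<^sub>R w) has_derivative (\<lambda>h. h *\<^sub>R w)) (at t)"
    by (auto intro!: derivative_eq_intros)
  from has_derivative_compose[OF this FD]
  have "((\<lambda>t. F (p + t *\<^sub>R w)) has_derivative (\<lambda>h. ?D (h *\<^sub>R w))) (at t)" .
  from bounded_linear.has_derivative[OF assms(2) this]
  have "((\<lambda>t. l (F (p + t *\<^sub>R w))) has_derivative (\<lambda>h. l (?D (h *\<^sub>R w)))) (at t)" .
  moreover have "linear ?D" "linear l"
    using assms linear_frechet_derivative bounded_linear.linear by blast+
  then have "(\<lambda>h. l (?D (h *\<^sub>R w))) = (*) (l (?D w))"
    by (simp add: fun_eq_iff linear_cmul)
  ultimately show ?thesis
    by (simp add: has_field_derivative_def)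
qed

section \<open>Planar maps whose derivative form has a constant weak sign\<close>

context
  fixes F :: "real ^ 2 \<Rightarrow> real ^ 2" and s :: real
  assumes diff: "\<And>p. F differentiable at p"
    and form: "\<And>p v. 0 \<le> s * wedge v (deriv_at F p v)"
    and s: "s \<noteq> 0"
begin

private lemma wedge_derivative:
  "((\<lambda>t. s * wedge w (F (p + t *\<^sub>R w))) has_real_derivative
      s * wedge w (deriv_at F (p + t *\<^sub>R w) w)) (at t)"
  using diff bounded_linear_const_mult[OF bounded_linear_wedge]
  by (rule has_real_derivative_along_segment)

private lemma wedge_mono:
  "t \<le> u \<Longrightarrow> s * wedge w (F (p + t *\<^sub>R w)) \<le> s * wedge w (F (p + u *\<^sub>R w))"
  by (erule DERIV_nonneg_imp_nondecreasing) (intro exI conjI, rule wedge_derivative, rule form)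

lemma wedge_increment_nonneg: "0 \<le> s * wedge (q - p) (F q - F p)"
  using wedge_mono[of 0 1 "q - p" p]
  by (simp add: linear_diff[OF bounded_linear.linear[OF bounded_linear_wedge]] right_diff_distrib)

text \<open>The mean value theorem generally fails for vector values. Here it applies to the
  component along w, while the component across w is monotone with equal end values, hence constant
  on the segment, so its derivative vanishes at the same point.\<close>

lemma derivative_eq_increment_if_wedge_eq_0:
  assumes "wedge (q - p) (F q - F p) = 0" "p \<noteq> q"
  obtains z where "deriv_at F z (q - p) = F q - F p"
proof -
  define w where "w = q - p"
  note lin = bounded_linear.linear[OF bounded_linear_wedge]
  have "((\<lambda>t. w \<bullet> F (p + t *\<^sub>R w)) has_real_derivative w \<bullet> deriv_at F (p + t *\<^sub>R w) w) (at t)" for t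
    using diff bounded_linear_inner_right by (rule has_real_derivative_along_segment)
  from MVT2[OF zero_less_one this]
  obtain t where t: "0 < t" "t < 1" and inner: "w \<bullet> (F q - F p) = w \<bullet> deriv_at F (p + t *\<^sub>R w) w"
    by (auto simp: w_def inner_diff_right)
  define h where "h = (\<lambda>t. s * wedge w (F (p + t *\<^sub>R w)))"
  have mono: "h x \<le> h y" if "x \<le> y" for x y
    unfolding h_def using that by (rule wedge_mono)
  have h01: "h 1 = h 0"
    using assms(1) by (simp add: h_def w_def linear_diff[OF lin])
  \<comment> \<open>The radius keeps y between 0 and 1, so h y is at most h 1 = h 0, which is at
    most h t: the point t is a local maximum.\<close>
  have "h y \<le> h t" if "\<bar>t - y\<bar> < min t (1 - t)" for y
    using mono[of y 1] mono[of 0 t] h01 t that by (simp add: abs_if split: if_splits)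
  then have "s * wedge w (deriv_at F (p + t *\<^sub>R w) w) = 0"
    using t unfolding h_def by (intro DERIV_local_max[OF wedge_derivative, where d = "min t (1 - t)"]) auto
  then have "wedge w (F q - F p - deriv_at F (p + t *\<^sub>R w) w) = 0"
    using s assms(1) by (simp add: linear_diff[OF lin] flip: w_def)
  moreover have "w \<bullet> (F q - F p - deriv_at F (p + t *\<^sub>R w) w) = 0"
    using inner by (simp add: inner_diff_right)
  ultimately have "F q - F p - deriv_at F (p + t *\<^sub>R w) w = 0"
    using assms(2) by (intro inner_wedge_eq_0_imp_eq_0) (auto simp: w_def)
  then show thesis
    using that by (simp add: w_def)
qed

lemma eigenvalues_if_two_fixpoints:
  assumes "p \<in> Fix (F \<circ> F)" "q \<in> Fix (F \<circ> F)" "p \<noteq> q"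
  obtains c d where "complex_of_real c \<in> Spec F" "complex_of_real d \<in> Spec F" "c * d = 1"
proof -
  have fx: "F (F p) = p" "F (F q) = q"
    using assms by (auto simp: Fix_def)
  then have ne: "F p \<noteq> F q"
    using assms(3) by metis
  let ?w = "q - p" and ?w' = "F q - F p"
  have "s * wedge ?w ?w' = 0"
    using wedge_increment_nonneg[of q p] wedge_increment_nonneg[of "F q" "F p"]
    by (simp add: fx wedge_swap[of ?w' ?w])
  then have w0: "wedge ?w ?w' = 0" "wedge ?w' ?w = 0"
    using s wedge_swap[of ?w' ?w] by auto
  obtain c where c: "?w' = c *\<^sub>R ?w"
    using wedge_eq_0_imp_parallel w0(1) assms(3) by (metis eq_iff_diff_eq_0)
  then have c0: "c \<noteq> 0"
    using ne by auto
  have d: "?w = (1 / c) *\<^sub>R ?w'"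
    unfolding c using c0 by simp
  obtain z where z: "deriv_at F z ?w = ?w'"
    using derivative_eq_increment_if_wedge_eq_0 w0(1) assms(3) by blast
  obtain z' where z': "deriv_at F z' ?w' = ?w"
    using derivative_eq_increment_if_wedge_eq_0[of "F q" "F p"] w0(2) ne by (auto simp: fx)
  show thesis
  proof (rule that)
    show "complex_of_real c \<in> Spec F"
      using of_real_in_Spec[OF diff, of z ?w c] z c assms(3) by simp
    show "complex_of_real (1 / c) \<in> Spec F"
      using of_real_in_Spec[OF diff, of z' ?w' "1 / c"] z' d ne by simp
  qed (use c0 in simp)
qed

end

section \<open>Global sign and the two spectral alternatives\<close>

theorem theorem4:
  fixes \<epsilon> :: real and F :: "real ^ 2 \<Rightarrow> real ^ 2"
  assumes "\<epsilon> > 0"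
    and "C1_map F"
    and "\<And>p. \<not> homothety (deriv_at F p)"
    and "\<And>p. \<not> (\<exists>x::real. simple_eigenvalue (matrix (deriv_at F p)) x)"
    and "Spec F \<inter> (complex_of_real ` {x. \<bar>x\<bar> \<ge> 1} \<union> {0}) = {} \<or>
         Spec F \<inter> complex_of_real ` {x. \<bar>x\<bar> \<le> 1 + \<epsilon>} = {}"
  shows "finite (Fix (F \<circ> F)) \<and> card (Fix (F \<circ> F)) \<le> 1"
proof -
  have diff: "F differentiable at p" for p
    using assms(2) by (auto simp: C1_map_def differentiable_def)
  note lin = linear_frechet_derivative[OF diff]
  note disc = disc_nonpos_if_no_simple_eigenvalue[OF assms(4)]
  define r where "r p = matrix (deriv_at F p) $ 2 $ 1 - matrix (deriv_at F p) $ 1 $ 2" for p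
  have r: "r p \<noteq> 0" for p
    unfolding r_def using lin assms(3) disc by (rule offdiag_neq_if_disc_nonpos)
  have "continuous_on UNIV r"
    unfolding r_def using assms(2) by (intro continuous_intros continuous_on_matrix_deriv_at)
  \<comment> \<open>The origin is an arbitrary base point; \<open>r 0\<close> becomes the constant
    \<open>s\<close> of the context above.\<close>
  then have sign: "0 < r p * r 0" for p
    using r by (intro constant_sign_on_connected[of UNIV]) auto
  have form: "0 \<le> r 0 * wedge v (deriv_at F p v)" for p v
  proof -
    have "0 \<le> r p * wedge v (deriv_at F p v)"
      unfolding r_def using lin disc by (rule wedge_semidefinite_if_disc_nonpos)
    then show ?thesis
      using sign[of p] by (auto simp: zero_le_mult_iff zero_less_mult_iff)
  qed
  have unique: "p = q" if pq: "p \<in> Fix (F \<circ> F)" "q \<in> Fix (F \<circ> F)" for p q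
  proof (rule ccontr)
    assume "p \<noteq> q"
    from eigenvalues_if_two_fixpoints[OF diff form r pq this]
    obtain c d where cd: "complex_of_real c \<in> Spec F" "complex_of_real d \<in> Spec F" "c * d = 1"
      by blast
    \<comment> \<open>The first alternative puts both c and d strictly inside the unit circle, the
      second both strictly outside; neither fits a product of modulus 1.\<close>
    have one: "\<bar>c\<bar> * \<bar>d\<bar> = 1"
      using cd(3) by (metis abs_mult abs_one)
    from assms(5) show False
    proof
      assume "Spec F \<inter> (complex_of_real ` {x. \<bar>x\<bar> \<ge> 1} \<union> {0}) = {}"
      then have "\<bar>c\<bar> < 1" "\<bar>d\<bar> < 1"
        using cd(1,2) by (auto simp: disjoint_iff not_le[symmetric])
      then show False
        using one mult_strict_mono[of "\<bar>c\<bar>" 1 "\<bar>d\<bar>" 1] by simp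
    next
      assume "Spec F \<inter> complex_of_real ` {x. \<bar>x\<bar> \<le> 1 + \<epsilon>} = {}"
      then have "\<not> \<bar>c\<bar> \<le> 1 + \<epsilon>" "\<not> \<bar>d\<bar> \<le> 1 + \<epsilon>"
        using cd(1,2) by blast+
      then have "1 < \<bar>c\<bar>" "1 < \<bar>d\<bar>"
        using assms(1) by auto
      then show False
        using one less_1_mult[of "\<bar>c\<bar>" "\<bar>d\<bar>"] by linarith
    qed
  qed
  \<comment> \<open>Since \<open>card\<close> is 0 on infinite sets, finiteness is established
    before the cardinality bound.\<close>
  have finite: "finite (Fix (F \<circ> F))"
  proof (cases "Fix (F \<circ> F) = {}")
    case False
    then obtain p where "Fix (F \<circ> F) \<subseteq> {p}"
      using unique by blast
    then show ?thesis
      by (rule finite_subset) simp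
  qed simp
  then show ?thesis
    using unique card_le_Suc0_iff_eq[OF finite] by auto
qed

end
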